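(* Let $B>3$ be an odd integer, and for each positive integer $L$ let $N_B(L)$ be the number of terminal cycles of length $L$ of the four-digit Kaprekar map in base $B$, with constant digit strings omitted. Then $$N_B(L)=\mu_B(L)\left\lfloor\frac{L-1}{2}\right\rfloor+\mu_B(2L)+\binom{\mu_B(L)}{2}L+\sum_{\substack{a<b\\ \operatorname{lcm}(a,b)=L}}\mu_B(a)\,\mu_B(b)\gcd(a,b),$$ where the sum runs over pairs of positive integers $a<b$ with $\operatorname{lcm}(a,b)=L$, and where for a positive integer $a$ $$\mu_B(a)=\sum_{\substack{n\mid B,\ n>1\\ \lambda(n)=a}}\frac{\varphi(n)}{2a},$$ with $\mu_B(a)=0$ if no divisor $n$ contributes to the sum.
   Context: For an odd integer $n>1$, $\lambda(n)=\min\{m>0 : 2^m\equiv\pm1\pmod n\}$, and $\varphi$ is Euler's totient function. A four-digit string in base $B$ is a sequence of four digits in $\{0,\dots,B-1\}$ (leading zeros allowed). The four-digit Kaprekar map in base $B$ sends a string whose digits sorted in non-increasing order are $a_1\ge a_2\ge a_3\ge a_4$ to the four-digit base-$B$ string (with leading zeros if needed) of the number $$(a_1B^3+a_2B^2+a_3B+a_4)-(a_4B^3+a_3B^2+a_2B+a_1).$$ Constant strings (all four digits equal) are excluded. A terminal cycle is a periodic orbit of this map consisting of nonconstant strings, and its length is the number of distinct strings in it (the minimal period). *)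

theory Defs
  imports
    Complex_Main
    "HOL-Combinatorics.Orbits"
    "HOL-Number_Theory.Number_Theory"
begin

text \<open>Digit strings are lists of length four, most significant digit first.\<close>

definition digit_strings :: "nat \<Rightarrow> nat list set" where
  "digit_strings B = {s. length s = 4 \<and> set s \<subseteq> {0..<B}}"

definition nonconstant_strings :: "nat \<Rightarrow> nat list set" where
  "nonconstant_strings B = {s \<in> digit_strings B. \<exists>x\<in>set s. \<exists>y\<in>set s. x \<noteq> y}"

definition string_value :: "nat \<Rightarrow> nat list \<Rightarrow> nat" where
  "string_value B s = s ! 0 * B ^ 3 + s ! 1 * B ^ 2 + s ! 2 * B + s ! 3"

definition string_of_number :: "nat \<Rightarrow> nat \<Rightarrow> nat list" where
  "string_of_number B n =
    [n div B ^ 3 mod B, n div B ^ 2 mod B, n div B mod B, n mod B]"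

text \<open>The subtraction on natural numbers never truncates on digit strings, because
  the non-increasing arrangement of the digits has the larger value.\<close>

definition kaprekar :: "nat \<Rightarrow> nat list \<Rightarrow> nat list" where
  "kaprekar B s =
    string_of_number B (string_value B (rev (sort s)) - string_value B (sort s))"

text \<open>\<^term>\<open>cyclic_on f C\<close> states that \<^term>\<open>C\<close> is the forward orbit under \<^term>\<open>f\<close> of one of
  its own elements, with the orbit of \<open>s\<close> starting at \<open>f s\<close>; that is, \<^term>\<open>C\<close> is a
  periodic orbit.\<close>

definition terminal_cycles :: "nat \<Rightarrow> nat list set set" where
  "terminal_cycles B = {C. C \<subseteq> nonconstant_strings B \<and> cyclic_on (kaprekar B) C}"

definition num_terminal_cycles :: "nat \<Rightarrow> nat \<Rightarrow> nat" where
  "num_terminal_cycles B L = card {C \<in> terminal_cycles B. card C = L}"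

definition lam :: "nat \<Rightarrow> nat" where
  "lam n = (LEAST m. m > 0 \<and> ([2 ^ m = 1] (mod int n) \<or> [2 ^ m = - 1] (mod int n)))"

definition mu :: "nat \<Rightarrow> nat \<Rightarrow> real" where
  "mu B a = (\<Sum>n | n dvd B \<and> n > 1 \<and> lam n = a. real (totient n) / (2 * real a))"

end

theory Submission
  imports Defs "HOL-Combinatorics.Cycles"
begin

text \<open>Let \<open>a \<ge> b \<ge> c \<ge> d\<close> be the sorted digits of a string. Its image depends only on
  \<open>x = a - d\<close> and \<open>y = b - c\<close>, and for \<open>y > 0\<close> it has the digits \<open>x, y - 1, B - 1 - y, B - x\<close>.
  Hence, with \<open>g t = \<bar>B - 2 t\<bar>\<close>, the pair \<open>{x, y}\<close> moves to \<open>{g x, g y}\<close> unless \<open>g x = g y\<close>.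
  The map \<open>g\<close> permutes the odd numbers below \<open>B\<close>, which represent the nonzero residues
  modulo \<open>B\<close> up to sign, and acts on them as doubling; so it has \<open>\<mu>\<^sub>B(a)\<close> cycles of length \<open>a\<close>.
  Every nonconstant string eventually reaches a pair of two distinct odd numbers,
  so the terminal cycles are the cycles of \<open>g\<close> on two-element subsets. Two points on different
  cycles of lengths \<open>a\<close> and \<open>b\<close> span a cycle of length \<open>lcm a b\<close>; two points on a common cycle
  of length \<open>a\<close> span one of length \<open>a\<close>, or \<open>a / 2\<close> if they are antipodal. The formula follows by
  counting the ordered pairs of points that span a cycle of length \<open>L\<close>.\<close>

section \<open>Cycles of a map and of its action on two-element subsets\<close>

lemma least_power_pos: "x \<in> orbit f x \<Longrightarrow> 0 < least_power f x"
  by (auto simp: orbit_altdef intro: least_powerI(2)[OF sym])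

lemma funpow_least_power: "x \<in> orbit f x \<Longrightarrow> (f ^^ least_power f x) x = x"
  by (auto simp: orbit_altdef intro: least_powerI(1)[OF sym])

lemma funpow_fixed_iff:
  assumes "x \<in> orbit f x"
  shows "(f ^^ n) x = x \<longleftrightarrow> least_power f x dvd n"
proof
  assume "least_power f x dvd n"
  then have "n mod least_power f x = 0" by simp
  with funpow_mod_eq[OF funpow_least_power[OF assms], of n] have "(f ^^ n) x = (f ^^ 0) x"
    by (simp only:)
  then show "(f ^^ n) x = x" by simp
qed (rule least_power_minimal)

lemma least_power_eqI:
  assumes "m > 0" and "\<And>n. (f ^^ n) x = x \<longleftrightarrow> m dvd n"
  shows "least_power f x = m"
proof (rule antisym)
  have *: "(f ^^ m) x = x" by (rule iffD2[OF assms(2)]) simp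
  then show "least_power f x \<le> m"
    using \<open>m > 0\<close> by (rule least_power_le)
  note least_powerI[OF * \<open>m > 0\<close>]
  then show "m \<le> least_power f x"
    using assms(2)[of "least_power f x"] by (intro dvd_imp_le) simp_all
qed

text \<open>Periodicity of \<open>x\<close> alone lets iterates be cancelled, although
  \<open>f\<close> need not be injective: some further iterate brings \<open>(f ^^ i) x\<close> back
  to \<open>x\<close>.\<close>

lemma funpow_eq_iff_cong:
  assumes "x \<in> orbit f x"
  shows "(f ^^ i) x = (f ^^ j) x \<longleftrightarrow> [i = j] (mod least_power f x)"
proof -
  let ?p = "least_power f x"
  have *: "i \<le> j \<Longrightarrow> (f ^^ i) x = (f ^^ j) x \<longleftrightarrow> [i = j] (mod ?p)" for i j
  proof
    assume "i \<le> j" and eq: "(f ^^ i) x = (f ^^ j) x"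
    \<comment> \<open>Chosen so that \<open>k + i\<close> is a multiple of the period; applying
      \<open>f ^^ k\<close> thus undoes \<open>f ^^ i\<close> on \<open>x\<close>.\<close>
    define k where "k = i * ?p - i"
    have p: "?p > 0" by (rule least_power_pos[OF assms])
    then have k: "k + i = i * ?p" by (simp add: k_def)
    have "(f ^^ (k + j)) x = (f ^^ (k + i)) x"
      by (simp only: funpow_add o_apply eq)
    also have "\<dots> = x" using assms k by (simp add: funpow_fixed_iff)
    finally have "?p dvd k + j" using assms by (simp add: funpow_fixed_iff)
    moreover have "k + j = (k + i) + (j - i)" using \<open>i \<le> j\<close> by simp
    ultimately have "?p dvd j - i" unfolding k by (simp add: dvd_add_right_iff)
    then show "[i = j] (mod ?p)"
      using \<open>i \<le> j\<close> by (simp add: cong_altdef_nat cong_sym_eq[of i])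
  next
    assume "[i = j] (mod ?p)"
    then show "(f ^^ i) x = (f ^^ j) x"
      using funpow_mod_eq[OF funpow_least_power[OF assms], of i]
        funpow_mod_eq[OF funpow_least_power[OF assms], of j] by (simp add: cong_def)
  qed
  show ?thesis
    using *[of i j] *[of j i] nat_le_linear[of i j] cong_sym_eq[of i] by auto
qed

lemma orbit_eq_image:
  assumes "x \<in> orbit f x"
  shows "orbit f x = (\<lambda>k. (f ^^ k) x) ` {..<least_power f x}"
  using orbit_altdef_bounded[OF funpow_least_power[OF assms] least_power_pos[OF assms]] by auto

lemma inj_on_funpow_least_power:
  assumes "x \<in> orbit f x"
  shows "inj_on (\<lambda>k. (f ^^ k) x) {..<least_power f x}"
  using assms by (auto intro!: inj_onI simp: funpow_eq_iff_cong cong_def)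

lemma card_orbit:
  assumes "x \<in> orbit f x"
  shows "card (orbit f x) = least_power f x"
  using card_image[OF inj_on_funpow_least_power[OF assms]] by (simp add: orbit_eq_image[OF assms])

text \<open>Extending \<open>f\<close> from \<open>S\<close> by the identity gives a permutation
  with finite support, whose orbits inside \<open>S\<close> are those of \<open>f\<close>.\<close>

lemma self_in_orbit_of_inj_on:
  assumes "finite S" "f ` S \<subseteq> S" "inj_on f S" "x \<in> S"
  shows "x \<in> orbit f x"
proof -
  let ?h = "perm_restrict f S"
  have "bij_betw f S S"
    using endo_inj_surj[OF assms(1-3)] assms(3) by (simp add: bij_betw_def)
  then have "bij_betw ?h S S"
    using bij_betw_cong[of S ?h f] by (simp add: perm_restrict_def)
  then have "?h permutes S"
    by (rule bij_imp_permutes) (auto simp: perm_restrict_def)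
  then have "permutation ?h"
    unfolding permutation_permutes using \<open>finite S\<close> by blast
  then have "x \<in> orbit ?h x" by (rule permutation_self_in_orbit)
  also have "orbit ?h x = orbit f x"
    using assms(2) by (intro orbit_cong0[OF \<open>x \<in> S\<close>]) (auto simp: perm_restrict_def)
  finally show ?thesis .
qed

lemma orbit_subset_of_closed:
  assumes "f ` S \<subseteq> S" "x \<in> S"
  shows "orbit f x \<subseteq> S"
proof
  fix y assume "y \<in> orbit f x"
  then show "y \<in> S" using assms by induct auto
qed

lemma least_power_orbit:
  assumes "x \<in> orbit f x" "y \<in> orbit f x"
  shows "least_power f y = least_power f x"
proof -
  have "y \<in> orbit f y" using assms by (rule self_in_orbit_trans)
  moreover have "orbit f y = orbit f x"
    using orbit_cyclic_eq3[of f "orbit f x" y] assms by (auto simp: cyclic_on_def)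
  ultimately show ?thesis
    using card_orbit[of y f] card_orbit[of x f] assms by simp
qed

text \<open>The cycles of size \<open>L\<close> are disjoint and together exhaust the points of
  period \<open>L\<close>. The product form avoids a division.\<close>

lemma card_cycles:
  assumes "finite T" "f ` T \<subseteq> T" and per: "\<And>x. x \<in> T \<Longrightarrow> x \<in> orbit f x"
  shows "L * card {C. C \<subseteq> T \<and> cyclic_on f C \<and> card C = L} = card {x \<in> T. least_power f x = L}"
proof -
  let ?\<C> = "{C. C \<subseteq> T \<and> cyclic_on f C \<and> card C = L}"
  have U: "\<Union>?\<C> = {x \<in> T. least_power f x = L}"
  proof (intro equalityI subsetI)
    fix x assume "x \<in> \<Union>?\<C>"
    then obtain C where C: "C \<subseteq> T" "cyclic_on f C" "card C = L" "x \<in> C" by auto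
    then have "orbit f x = C" by (intro orbit_cyclic_eq3)
    then have "least_power f x = L" using C card_orbit[of x f] by simp
    then show "x \<in> {x \<in> T. least_power f x = L}" using C by blast
  next
    fix x assume x: "x \<in> {x \<in> T. least_power f x = L}"
    then have "x \<in> orbit f x" using per by blast
    moreover from this have "card (orbit f x) = L" using x card_orbit[of x f] by simp
    moreover have "orbit f x \<subseteq> T" using x by (intro orbit_subset_of_closed assms) simp
    ultimately have "orbit f x \<in> ?\<C>" by (auto intro: cyclic_on_singleI)
    then show "x \<in> \<Union>?\<C>" using \<open>x \<in> orbit f x\<close> by blast
  qed
  have "L * card ?\<C> = card (\<Union>?\<C>)"
  proof (rule card_partition)
    show "finite ?\<C>" using \<open>finite T\<close> by simp
    show "finite (\<Union>?\<C>)" unfolding U using \<open>finite T\<close> by simp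
    show "c1 \<inter> c2 = {}" if "c1 \<in> ?\<C>" "c2 \<in> ?\<C>" "c1 \<noteq> c2" for c1 c2
    proof (rule ccontr)
      assume "c1 \<inter> c2 \<noteq> {}"
      then obtain x where "x \<in> c1" "x \<in> c2" by auto
      then have "orbit f x = c1" "orbit f x = c2" using that by (simp_all add: orbit_cyclic_eq3)
      then show False using \<open>c1 \<noteq> c2\<close> by simp
    qed
  qed auto
  then show ?thesis unfolding U .
qed

section \<open>Periods of two-element sets under the image map\<close>

lemma image_funpow:
  fixes f :: "'a \<Rightarrow> 'a"
  shows "((`) f ^^ n) A = (f ^^ n) ` A"
  by (induct n) (auto simp: image_image)

text \<open>An iterate never carries \<open>x\<close> to \<open>y\<close>, so it preserves
  \<open>{x, y}\<close> only by fixing both points.\<close>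

lemma least_power_image_lcm:
  assumes x: "x \<in> orbit f x" and y: "y \<in> orbit f y" and "y \<notin> orbit f x"
  shows "least_power ((`) f) {x, y} = lcm (least_power f x) (least_power f y)"
proof (rule least_power_eqI)
  show "0 < lcm (least_power f x) (least_power f y)"
    using least_power_pos[OF x] least_power_pos[OF y] by (simp add: lcm_pos_nat)
  fix n
  have "(f ^^ n) x \<noteq> y" using funpow_in_orbit[OF x, of n] assms(3) by auto
  then have "((`) f ^^ n) {x, y} = {x, y} \<longleftrightarrow> (f ^^ n) x = x \<and> (f ^^ n) y = y"
    by (auto simp: image_funpow doubleton_eq_iff)
  then show "((`) f ^^ n) {x, y} = {x, y} \<longleftrightarrow> lcm (least_power f x) (least_power f y) dvd n"
    using x y by (simp add: funpow_fixed_iff)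
qed

text \<open>An iterate preserves the pair by fixing both points or by swapping them. A swap by
  \<open>f ^^ n\<close> requires \<open>n\<close> to be congruent to both \<open>d\<close> and
  \<open>- d\<close> modulo the period, hence the period to divide \<open>2 * d\<close>; as
  \<open>0 < d < p\<close> for the period \<open>p\<close>, this means that the points are
  antipodal.\<close>

lemma least_power_image_same_orbit:
  assumes x: "x \<in> orbit f x" and d: "0 < d" "d < least_power f x"
  shows "least_power ((`) f) {x, (f ^^ d) x} = (if 2 * d = least_power f x then d else least_power f x)"
proof (rule least_power_eqI)
  let ?p = "least_power f x"
  show "0 < (if 2 * d = ?p then d else ?p)" using d by auto
  fix n
  have "((`) f ^^ n) {x, (f ^^ d) x} = {x, (f ^^ d) x} \<longleftrightarrow>
      (f ^^ n) x = (f ^^ 0) x \<and> (f ^^ (n + d)) x = (f ^^ d) x \<or>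
      (f ^^ n) x = (f ^^ d) x \<and> (f ^^ (n + d)) x = (f ^^ 0) x"
    by (simp add: image_funpow doubleton_eq_iff funpow_add)
  also have "\<dots> \<longleftrightarrow> ?p dvd n \<or> [n = d] (mod ?p) \<and> ?p dvd n + d"
    unfolding funpow_eq_iff_cong[OF x] by (auto simp: cong_0_iff cong_add_rcancel_0_nat)
  also have "\<dots> \<longleftrightarrow> (if 2 * d = ?p then d else ?p) dvd n"
  proof (cases "2 * d = ?p")
    case True
    have "2 * d dvd n \<or> [n = d] (mod 2 * d) \<and> 2 * d dvd n + d \<longleftrightarrow> d dvd n"
    proof
      assume "d dvd n"
      then obtain k where n: "n = d * k" by auto
      show "2 * d dvd n \<or> [n = d] (mod 2 * d) \<and> 2 * d dvd n + d"
      proof (cases "even k")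
        case False
        then obtain j where "k = 2 * j + 1" by (auto elim: oddE)
        then have n: "n = d + 2 * d * j" using n by (simp add: algebra_simps)
        have "n + d = 2 * d * (j + 1)" using n by (simp add: algebra_simps)
        then have "2 * d dvd n + d" by (metis dvd_triv_left)
        moreover have "[n = d] (mod 2 * d)" unfolding n by (simp add: cong_def)
        ultimately show ?thesis by blast
      qed (use n in auto)
    next
      assume "2 * d dvd n \<or> [n = d] (mod 2 * d) \<and> 2 * d dvd n + d"
      then show "d dvd n"
        by (metis dvd_add_left_iff dvd_refl dvd_mult_right)
    qed
    then show ?thesis unfolding True[symmetric] by simp
  next
    case False
    have "\<not> ([n = d] (mod ?p) \<and> ?p dvd n + d)"
    proof
      assume *: "[n = d] (mod ?p) \<and> ?p dvd n + d"
      then have "[n + d = d + d] (mod ?p)" by (simp add: cong_add)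
      with * have "?p dvd 2 * d" by (metis cong_dvd_iff mult_2)
      then obtain k where k: "2 * d = ?p * k" by auto
      have "?p * k < ?p * 2" using d unfolding k[symmetric] by simp
      then have "k < 2" by simp
      moreover have "k \<noteq> 0" using k d by (cases k) auto
      ultimately have "k = 1" by simp
      with k False show False by simp
    qed
    then show ?thesis using False by argo
  qed
  finally show "((`) f ^^ n) {x, (f ^^ d) x} = {x, (f ^^ d) x} \<longleftrightarrow>
      (if 2 * d = ?p then d else ?p) dvd n" .
qed

text \<open>Each two-element set comes from exactly two ordered pairs. Ordered pairs can be counted
  by fixing the first point and summing over it.\<close>

lemma card_doubletons:
  assumes "finite S"
  shows "2 * card {A. A \<subseteq> S \<and> card A = 2 \<and> P A} =
    card {(x, y). x \<in> S \<and> y \<in> S \<and> x \<noteq> y \<and> P {x, y}}"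
proof -
  let ?\<A> = "{A. A \<subseteq> S \<and> card A = 2 \<and> P A}"
  let ?R = "{(x, y). x \<in> S \<and> y \<in> S \<and> x \<noteq> y \<and> P {x, y}}"
  let ?h = "\<lambda>(x, y). {x, y}"
  have fin: "finite ?R" by (rule finite_subset[of _ "S \<times> S"]) (use assms in auto)
  have fibre: "card {q \<in> ?R. ?h q = A} = 2" if A: "A \<in> ?\<A>" for A
  proof -
    obtain a b where ab: "A = {a, b}" "a \<noteq> b"
      using A by (auto simp: card_2_iff)
    have "P {a, b}" "P {b, a}" "a \<in> S" "b \<in> S"
      using A by (simp_all add: ab insert_commute)
    then have "{q \<in> ?R. ?h q = A} = {(a, b), (b, a)}"
      using ab(2) unfolding ab(1) by (auto simp: doubleton_eq_iff)
    then show ?thesis using ab by simp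
  qed
  have "?h ` ?R \<subseteq> ?\<A>" by auto
  then have "card ?R = (\<Sum>A\<in>?\<A>. \<Sum>q\<in>{q \<in> ?R. ?h q = A}. 1)"
    using sum.group[OF fin, of ?\<A> ?h "\<lambda>_. 1::nat"] assms by simp
  also have "\<dots> = (\<Sum>A\<in>?\<A>. 2)"
    by (intro sum.cong refl) (use fibre in auto)
  finally show ?thesis by simp
qed

text \<open>The partners are \<open>(f ^^ d) x\<close> with \<open>0 < d < p\<close>, where
  \<open>p\<close> is the period. If \<open>p = L\<close>, every distance \<open>d\<close> is
  admissible except the antipodal one, which leaves \<open>L - 1\<close> for odd and
  \<open>L - 2\<close> for even \<open>L\<close>. If \<open>p = 2 * L\<close>, only the antipode
  \<open>d = L\<close> is admissible.\<close>

lemma card_same_orbit_partners: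
  fixes L :: nat
  assumes x: "x \<in> orbit f x" and "L > 0"
  shows "card {y \<in> orbit f x. y \<noteq> x \<and> least_power ((`) f) {x, y} = L} =
    (if least_power f x = L then 2 * ((L - 1) div 2) else 0) +
    (if least_power f x = 2 * L then 1 else 0)"
proof -
  let ?p = "least_power f x"
  let ?D = "{d \<in> {0<..<?p}. (if 2 * d = ?p then d else ?p) = L}"
  have inj: "inj_on (\<lambda>k. (f ^^ k) x) {..<?p}" by (rule inj_on_funpow_least_power[OF x])
  have nz: "(f ^^ d) x \<noteq> x" if "0 < d" "d < ?p" for d
    using inj_onD[OF inj, of d 0] that by (metis funpow_0 gr_implies_not0 lessThan_iff less_trans)
  have "{y \<in> orbit f x. y \<noteq> x \<and> least_power ((`) f) {x, y} = L} = (\<lambda>k. (f ^^ k) x) ` ?D"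
  proof (intro equalityI subsetI)
    fix y assume y: "y \<in> {y \<in> orbit f x. y \<noteq> x \<and> least_power ((`) f) {x, y} = L}"
    then obtain d where d: "d < ?p" "y = (f ^^ d) x"
      using orbit_eq_image[OF x] by auto
    then have "0 < d" using y by (auto intro!: Nat.gr0I)
    then show "y \<in> (\<lambda>k. (f ^^ k) x) ` ?D"
      using y d least_power_image_same_orbit[OF x \<open>0 < d\<close> d(1)] by auto
  next
    fix y assume "y \<in> (\<lambda>k. (f ^^ k) x) ` ?D"
    then obtain d where d: "0 < d" "d < ?p" "(if 2 * d = ?p then d else ?p) = L"
        "y = (f ^^ d) x" by auto
    then show "y \<in> {y \<in> orbit f x. y \<noteq> x \<and> least_power ((`) f) {x, y} = L}"
      using least_power_image_same_orbit[OF x d(1,2)] nz[of d] funpow_in_orbit[OF x] by auto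
  qed
  moreover have "inj_on (\<lambda>k. (f ^^ k) x) ?D"
    using inj by (rule inj_on_subset) auto
  ultimately have "card {y \<in> orbit f x. y \<noteq> x \<and> least_power ((`) f) {x, y} = L} = card ?D"
    by (simp add: card_image)
  also have "card ?D = (if ?p = L then 2 * ((L - 1) div 2) else 0) + (if ?p = 2 * L then 1 else 0)"
  proof -
    consider "?p = L" | "?p = 2 * L" | "?p \<noteq> L" "?p \<noteq> 2 * L" by blast
    then show ?thesis
    proof cases
      case 1
      have D: "?D = {0<..<L} - {d. 2 * d = L}" using 1 by auto
      have "card ?D = 2 * ((L - 1) div 2)"
      proof (cases "even L")
        case True
        then obtain k where k: "L = 2 * k" by auto
        then have "?D = {0<..<L} - {k}" unfolding D by auto
        then show ?thesis using k \<open>L > 0\<close> by (auto simp: card_Diff_singleton)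
      next
        case False
        then have "?D = {0<..<L}" unfolding D by auto
        then show ?thesis using False by (auto elim: oddE)
      qed
      then show ?thesis using 1 \<open>L > 0\<close> by simp
    next
      case 2
      then have "?D = {L}" using \<open>L > 0\<close> by (auto split: if_splits)
      then show ?thesis using 2 \<open>L > 0\<close> by simp
    next
      case 3
      then have "?D = {}" by (auto split: if_splits)
      then show ?thesis using 3 by simp
    qed
  qed
  finally show ?thesis .
qed

section \<open>Counting two-element sets of a given period\<close>

lemma finite_lcm_eq:
  fixes L :: nat
  assumes "L > 0"
  shows "finite {(a, b). lcm a b = L}"
proof (rule finite_subset)
  show "{(a, b). lcm a b = L} \<subseteq> {..L} \<times> {..L}"
    using assms by (auto intro: dvd_imp_le)
qed simp

text \<open>Swapping matches the pairs with \<open>a < b\<close> to those with \<open>b < a\<close>,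
  and the diagonal contributes only \<open>(L, L)\<close>.\<close>

lemma sum_lcm_symmetric:
  fixes h :: "nat \<Rightarrow> real"
  assumes "L > 0"
  shows "(\<Sum>(a, b) | lcm a b = L. h a * h b) =
    2 * (\<Sum>(a, b) | 0 < a \<and> a < b \<and> lcm a b = L. h a * h b) + h L * h L"
proof -
  let ?M = "{(a, b). 0 < a \<and> a < b \<and> lcm a b = L}"
  have fin: "finite ?M"
    by (rule finite_subset[OF _ finite_lcm_eq[OF assms]]) auto
  have split: "{(a, b). lcm a b = L} = ?M \<union> (prod.swap ` ?M \<union> {(L, L)})"
  proof (intro equalityI subsetI)
    fix q assume "q \<in> {(a, b). lcm a b = L}"
    then obtain a b where q: "q = (a, b)" "lcm a b = L" by auto
    then have pos: "a > 0" "b > 0" using assms by (auto intro!: Nat.gr0I)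
    consider "a < b" | "b < a" | "a = b" by linarith
    then show "q \<in> ?M \<union> (prod.swap ` ?M \<union> {(L, L)})"
    proof cases
      case 2
      then have "(b, a) \<in> ?M" using q pos by (simp add: lcm.commute)
      then have "q \<in> prod.swap ` ?M" using q(1) by force
      then show ?thesis by blast
    qed (use q pos in auto)
  qed (auto simp: lcm.commute)
  have "(\<Sum>(a, b) | lcm a b = L. h a * h b) =
      (\<Sum>(a, b)\<in>?M. h a * h b) + ((\<Sum>(a, b)\<in>prod.swap ` ?M. h a * h b) + h L * h L)"
    unfolding split
    by (subst sum.union_disjoint, use fin in \<open>auto\<close>)+
  also have "(\<Sum>(a, b)\<in>prod.swap ` ?M. h a * h b) = (\<Sum>(a, b)\<in>?M. h a * h b)"
    by (subst sum.reindex) (auto simp: case_prod_unfold mult.commute)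
  finally show ?thesis by simp
qed

text \<open>Ordered pairs of points are grouped by their pair of periods; each group is a product
  set.\<close>

lemma sum_card_lcm:
  fixes p :: "'a \<Rightarrow> nat"
  assumes "finite S" "L > 0"
  shows "real (\<Sum>x\<in>S. card {y \<in> S. lcm (p x) (p y) = L}) =
    (\<Sum>(a, b) | lcm a b = L. real (card {x \<in> S. p x = a}) * real (card {x \<in> S. p x = b}))"
proof -
  let ?M = "{(a, b). lcm a b = L}"
  let ?R = "{(x, y). x \<in> S \<and> y \<in> S \<and> lcm (p x) (p y) = L}"
  have fin: "finite ?M" by (rule finite_lcm_eq[OF assms(2)])
  have R: "?R = Sigma S (\<lambda>x. {y \<in> S. lcm (p x) (p y) = L})" by auto
  have finR: "finite ?R" unfolding R using assms by auto
  let ?h = "\<lambda>q. (p (fst q), p (snd q))"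
  have sub: "?h ` ?R \<subseteq> ?M" by auto
  have "(\<Sum>x\<in>S. card {y \<in> S. lcm (p x) (p y) = L}) = card ?R"
    unfolding R using assms by (simp add: card_SigmaI)
  also have "card ?R = (\<Sum>m\<in>?M. \<Sum>q\<in>{q \<in> ?R. ?h q = m}. 1)"
    using sum.group[OF finR fin sub, of "\<lambda>_. 1::nat"] by simp
  also have "\<dots> = (\<Sum>(a, b)\<in>?M. card {x \<in> S. p x = a} * card {x \<in> S. p x = b})"
  proof (rule sum.cong[OF refl])
    fix m assume "m \<in> ?M"
    then obtain a b where m: "m = (a, b)" "lcm a b = L" by auto
    have "{q \<in> ?R. ?h q = m} = {x \<in> S. p x = a} \<times> {x \<in> S. p x = b}"
    proof (rule Set.set_eqI)
      fix q
      show "q \<in> {q \<in> ?R. ?h q = m} \<longleftrightarrow> q \<in> {x \<in> S. p x = a} \<times> {x \<in> S. p x = b}"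
        by (cases q) (simp add: m(1), metis m(2))
    qed
    then have "card {q \<in> ?R. ?h q = m} = card {x \<in> S. p x = a} * card {x \<in> S. p x = b}"
      by (simp only: card_cartesian_product)
    then show "(\<Sum>q\<in>{q \<in> ?R. ?h q = m}. 1) =
        (case m of (a, b) \<Rightarrow> card {x \<in> S. p x = a} * card {x \<in> S. p x = b})"
      by (simp add: m(1))
  qed
  finally show ?thesis by (simp add: case_prod_unfold)
qed

text \<open>For fixed \<open>x\<close>, counting all \<open>y\<close> by the lcm condition is right
  off the orbit of \<open>x\<close>; on that orbit the count is replaced by the one for points of a
  common cycle. After summation, \<open>c L * (c L - real L)\<close> counts the ordered pairs on two
  different cycles of the same length \<open>L\<close>.\<close>

lemma card_doubletons_least_power:
  fixes f :: "'a \<Rightarrow> 'a" and L :: nat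
  assumes S: "finite S" "f ` S \<subseteq> S" "inj_on f S" and "L > 0"
  defines "c \<equiv> \<lambda>a. real (card {x \<in> S. least_power f x = a})"
  shows "2 * real (card {A. A \<subseteq> S \<and> card A = 2 \<and> least_power ((`) f) A = L}) =
    c L * real (2 * ((L - 1) div 2)) + c (2 * L) + c L * (c L - real L)
    + 2 * (\<Sum>(a, b) | 0 < a \<and> a < b \<and> lcm a b = L. c a * c b)"
proof -
  let ?p = "least_power f"
  have self: "x \<in> orbit f x" if "x \<in> S" for x
    using self_in_orbit_of_inj_on[OF S that] .
  have sub: "orbit f x \<subseteq> S" if "x \<in> S" for x
    using orbit_subset_of_closed[OF S(2) that] .
  have partners: "real (card {y \<in> S. x \<noteq> y \<and> least_power ((`) f) {x, y} = L}) =
      real (card {y \<in> S. lcm (?p x) (?p y) = L})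
      + (real (2 * ((L - 1) div 2)) - real L) * of_bool (?p x = L) + of_bool (?p x = 2 * L)"
    if "x \<in> S" for x
  proof -
    note x = self[OF that]
    \<comment> \<open>\<open>?O\<close> is the part of \<open>?Y\<close> on the orbit of
      \<open>x\<close>: the whole orbit if the period of \<open>x\<close> is \<open>L\<close>, and
      empty otherwise. It is exchanged below for the true partners \<open>?Z\<close>.\<close>
    let ?Y = "{y \<in> S. lcm (?p x) (?p y) = L}" and ?O = "{y \<in> orbit f x. ?p x = L}"
    have "?O \<subseteq> ?Y"
      using sub[OF that] least_power_orbit[OF x] by auto
    moreover have "finite ?O" "card ?O = (if ?p x = L then L else 0)"
      using card_orbit[OF x] finite_orbit[OF x] by auto
    ultimately have 1: "real (card (?Y - ?O)) = real (card ?Y) - real L * of_bool (?p x = L)"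
      using S(1) card_mono[of ?Y ?O] by (simp add: card_Diff_subset of_nat_diff)
    let ?Z = "{y \<in> orbit f x. y \<noteq> x \<and> least_power ((`) f) {x, y} = L}"
    have "{y \<in> S. x \<noteq> y \<and> least_power ((`) f) {x, y} = L} = (?Y - ?O) \<union> ?Z"
    proof (intro equalityI subsetI)
      fix y assume y: "y \<in> {y \<in> S. x \<noteq> y \<and> least_power ((`) f) {x, y} = L}"
      then show "y \<in> (?Y - ?O) \<union> ?Z"
        using least_power_image_lcm[OF x self[of y]] by (cases "y \<in> orbit f x") auto
    next
      fix y assume y: "y \<in> (?Y - ?O) \<union> ?Z"
      then show "y \<in> {y \<in> S. x \<noteq> y \<and> least_power ((`) f) {x, y} = L}"
      proof
        assume y: "y \<in> ?Y - ?O"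
        then have "y \<notin> orbit f x" using least_power_orbit[OF x, of y] by auto
        then show ?thesis using y x least_power_image_lcm[OF x self[of y]] by auto
      qed (use sub[OF that] in auto)
    qed
    moreover have "(?Y - ?O) \<inter> ?Z = {}"
      using least_power_orbit[OF x] by auto
    moreover have "finite (?Y - ?O)" "finite ?Z"
      using S(1) finite_orbit[OF x] by auto
    ultimately have "real (card {y \<in> S. x \<noteq> y \<and> least_power ((`) f) {x, y} = L}) =
        real (card (?Y - ?O)) + real (card ?Z)"
      by (simp add: card_Un_disjoint)
    also have "card ?Z = 2 * ((L - 1) div 2) * of_bool (?p x = L) + of_bool (?p x = 2 * L)"
      using card_same_orbit_partners[OF x \<open>L > 0\<close>] by simp
    finally show ?thesis unfolding 1 by (simp add: algebra_simps)
  qed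
  let ?R = "{(x, y). x \<in> S \<and> y \<in> S \<and> x \<noteq> y \<and> least_power ((`) f) {x, y} = L}"
  have R: "?R = Sigma S (\<lambda>x. {y \<in> S. x \<noteq> y \<and> least_power ((`) f) {x, y} = L})" by auto
  have "2 * real (card {A. A \<subseteq> S \<and> card A = 2 \<and> least_power ((`) f) A = L}) = real (card ?R)"
    using card_doubletons[OF S(1), of "\<lambda>A. least_power ((`) f) A = L"] by linarith
  also have "card ?R = (\<Sum>x\<in>S. card {y \<in> S. x \<noteq> y \<and> least_power ((`) f) {x, y} = L})"
    unfolding R using S(1) by (simp add: card_SigmaI)
  also have "real \<dots> = real (\<Sum>x\<in>S. card {y \<in> S. lcm (?p x) (?p y) = L})
      + (real (2 * ((L - 1) div 2)) - real L) * c L + c (2 * L)"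
    using S(1) by (simp add: partners sum.distrib sum_distrib_left[symmetric] c_def Int_def)
  also have "real (\<Sum>x\<in>S. card {y \<in> S. lcm (?p x) (?p y) = L}) =
      2 * (\<Sum>(a, b) | 0 < a \<and> a < b \<and> lcm a b = L. c a * c b) + c L * c L"
    unfolding sum_card_lcm[OF S(1) \<open>L > 0\<close>] c_def[symmetric]
    using sum_lcm_symmetric[OF \<open>L > 0\<close>, of c] by (simp add: c_def)
  finally show ?thesis by (simp add: algebra_simps)
qed

section \<open>Doubling modulo an odd number, up to sign\<close>

text \<open>For odd \<open>B\<close> this is an odd representative of \<open>2 * x\<close> modulo
  \<open>B\<close> up to sign. The detour through the integers prevents truncation when
  \<open>2 * x > B\<close>.\<close>

definition fold_double :: "nat \<Rightarrow> nat \<Rightarrow> nat" where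
  "fold_double B x = nat \<bar>int B - 2 * int x\<bar>"

definition odds_below :: "nat \<Rightarrow> nat set" where
  "odds_below B = {x. odd x \<and> x < B}"

lemma finite_odds_below [simp]: "finite (odds_below B)"
  by (simp add: odds_below_def)

lemma odd_fold_double: "odd B \<Longrightarrow> odd (fold_double B x)"
  by (simp add: fold_double_def even_nat_iff)

lemma fold_double_less: "0 < x \<Longrightarrow> x < B \<Longrightarrow> fold_double B x < B"
  by (auto simp: fold_double_def)

lemma fold_double_odds_below:
  assumes "odd B"
  shows "fold_double B ` odds_below B \<subseteq> odds_below B"
proof clarify
  fix x assume x: "x \<in> odds_below B"
  then have "0 < x" "x < B" by (auto simp: odds_below_def odd_pos)
  then show "fold_double B x \<in> odds_below B"
    using odd_fold_double[OF assms, of x] fold_double_less[of x B] by (simp add: odds_below_def)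
qed

lemma fold_double_eq_iff:
  "fold_double B x = fold_double B y \<longleftrightarrow> x = y \<or> x + y = B"
  by (auto simp: fold_double_def)

lemma inj_on_fold_double:
  assumes "odd B"
  shows "inj_on (fold_double B) (odds_below B)"
proof (rule inj_onI)
  fix x y assume xy: "x \<in> odds_below B" "y \<in> odds_below B" "fold_double B x = fold_double B y"
  then have "even (x + y)" by (simp add: odds_below_def)
  with assms have "x + y \<noteq> B" by auto
  with xy(3) show "x = y" by (simp add: fold_double_eq_iff)
qed

text \<open>A congruence to the negative would force \<open>x + y = B\<close>, since
  \<open>0 < x + y < 2 * B\<close>; but the sum of two odd numbers is even.\<close>

lemma odds_below_eq_iff_cong:
  assumes "odd B" "x \<in> odds_below B" "y \<in> odds_below B"
  shows "x = y \<longleftrightarrow> [int x = int y] (mod int B) \<or> [int x = - int y] (mod int B)"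
proof
  assume "[int x = int y] (mod int B) \<or> [int x = - int y] (mod int B)"
  then show "x = y"
  proof
    assume "[int x = int y] (mod int B)"
    then show "x = y"
      using assms by (simp add: cong_int_iff odds_below_def cong_less_modulus_unique_nat)
  next
    assume "[int x = - int y] (mod int B)"
    then have "int B dvd int (x + y)" by (simp add: cong_iff_dvd_diff)
    then have "B dvd x + y" by (simp only: of_nat_dvd_iff)
    then obtain k where k: "x + y = B * k" by auto
    have "x + y < B * 2" "x + y > 0" using assms by (auto simp: odds_below_def odd_pos)
    then have "k < 2" "k \<noteq> 0" unfolding k by auto
    then have "k = 1" by simp
    with k have "x + y = B" by simp
    moreover have "even (x + y)" using assms by (simp add: odds_below_def)
    ultimately show ?thesis using \<open>odd B\<close> by simp
  qed
qed auto

text \<open>The absolute value loses the sign at each step, so iterated doubling is determined only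
  up to one overall sign.\<close>

lemma funpow_fold_double_cong:
  "[int ((fold_double B ^^ n) x) = 2 ^ n * int x] (mod int B) \<or>
   [int ((fold_double B ^^ n) x) = - (2 ^ n * int x)] (mod int B)"
proof (induction n)
  case (Suc n)
  let ?v = "(fold_double B ^^ n) x"
  have "int (fold_double B ?v) = int B - 2 * int ?v \<or> int (fold_double B ?v) = - (int B - 2 * int ?v)"
    by (auto simp: fold_double_def)
  then have step: "[int (fold_double B ?v) = 2 * int ?v] (mod int B) \<or>
      [int (fold_double B ?v) = - (2 * int ?v)] (mod int B)"
    by (auto simp: cong_iff_dvd_diff)
  have "[2 * int ?v = 2 ^ Suc n * int x] (mod int B) \<or> [2 * int ?v = - (2 ^ Suc n * int x)] (mod int B)"
    using Suc.IH by (auto dest: cong_scalar_left[of _ _ _ 2] simp: mult.assoc)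
  then have "[2 * int ?v = 2 ^ Suc n * int x] (mod int B) \<and> [- (2 * int ?v) = - (2 ^ Suc n * int x)] (mod int B)
      \<or> [2 * int ?v = - (2 ^ Suc n * int x)] (mod int B) \<and> [- (2 * int ?v) = 2 ^ Suc n * int x] (mod int B)"
    by (metis cong_minus_minus_iff minus_minus)
  with step show ?case by (auto intro: cong_trans simp del: power_Suc)
qed simp

text \<open>After division by the gcd, the cofactor of \<open>x\<close> is coprime to the new
  modulus and cancels. With \<open>a = 2 ^ n\<close> and \<open>b\<close> equal to \<open>1\<close>
  or \<open>- 1\<close>, this turns a return of \<open>x\<close> into the condition that defines
  \<open>lam\<close>.\<close>

lemma cong_mult_gcd_iff:
  fixes a b :: int and x B :: nat
  assumes "B > 0"
  shows "[a * int x = b * int x] (mod int B) \<longleftrightarrow> [a = b] (mod int (B div gcd x B))"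
proof -
  let ?d = "gcd x B"
  obtain x' n where x: "x = x' * ?d" and B: "B = n * ?d" and cop: "coprime x' n"
    using gcd_coprime_exists[of x B] assms by auto
  have d: "?d > 0" using assms by simp
  have n: "B div ?d = n" using B d by (metis nonzero_mult_div_cancel_right not_less0)
  have "[a * int x = b * int x] (mod int B) \<longleftrightarrow> int (n * ?d) dvd (a - b) * int (x' * ?d)"
    unfolding x[symmetric] B[symmetric] by (simp add: cong_iff_dvd_diff left_diff_distrib)
  also have "\<dots> \<longleftrightarrow> int n * int ?d dvd ((a - b) * int x') * int ?d"
    by (simp only: of_nat_mult mult.assoc)
  also have "\<dots> \<longleftrightarrow> int n dvd (a - b) * int x'"
    using d by (subst dvd_mult_cancel_right) auto
  also have "\<dots> \<longleftrightarrow> int n dvd a - b"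
    using cop by (intro coprime_dvd_mult_left_iff) (simp add: coprime_commute)
  finally show ?thesis by (simp add: n cong_iff_dvd_diff)
qed

lemma funpow_fold_double_fixed_iff:
  assumes "odd B" "x \<in> odds_below B"
  shows "(fold_double B ^^ n) x = x \<longleftrightarrow>
    [2 ^ n = 1] (mod int (B div gcd x B)) \<or> [2 ^ n = - 1] (mod int (B div gcd x B))"
proof -
  let ?v = "(fold_double B ^^ n) x"
  have "?v \<in> odds_below B"
    using fold_double_odds_below[OF assms(1)] assms(2) by (induction n) auto
  then have "?v = x \<longleftrightarrow> [int ?v = int x] (mod int B) \<or> [int ?v = - int x] (mod int B)"
    using assms by (intro odds_below_eq_iff_cong) auto
  also have "\<dots> \<longleftrightarrow> [2 ^ n * int x = int x] (mod int B) \<or> [2 ^ n * int x = - int x] (mod int B)"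
  proof -
    consider "[int ?v = 2 ^ n * int x] (mod int B)" | "[int ?v = - (2 ^ n * int x)] (mod int B)"
      using funpow_fold_double_cong[of n B x] by blast
    then show ?thesis
    proof cases
      case 1
      then have "[int ?v = c] (mod int B) \<longleftrightarrow> [2 ^ n * int x = c] (mod int B)" for c
        by (simp add: cong_def)
      then show ?thesis by simp
    next
      case 2
      then have "[int ?v = c] (mod int B) \<longleftrightarrow> [- (2 ^ n * int x) = c] (mod int B)" for c
        by (simp add: cong_def)
      moreover have "[- (2 ^ n * int x) = c] (mod int B) \<longleftrightarrow> [2 ^ n * int x = - c] (mod int B)" for c
        by (metis cong_minus_minus_iff minus_minus)
      ultimately show ?thesis by auto
    qed
  qed
  also have "\<dots> \<longleftrightarrow> [2 ^ n = 1] (mod int (B div gcd x B)) \<or> [2 ^ n = - 1] (mod int (B div gcd x B))"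
    using assms cong_mult_gcd_iff[of B "2 ^ n" x 1] cong_mult_gcd_iff[of B "2 ^ n" x "- 1"]
    by (simp add: odd_pos)
  finally show ?thesis .
qed

lemma least_power_fold_double:
  assumes "odd B" "x \<in> odds_below B"
  shows "least_power (fold_double B) x = lam (B div gcd x B)"
  unfolding least_power_def lam_def funpow_fold_double_fixed_iff[OF assms]
  by (simp only: conj_commute)

text \<open>The reflection \<open>k \<mapsto> B - k\<close> keeps the gcd with \<open>B\<close> and,
  as \<open>B\<close> is odd, flips the parity. So exactly half of the \<open>totient n\<close>
  numbers with the given gcd are odd.\<close>

lemma card_odds_below_gcd:
  assumes "odd B" "n dvd B" "n > 1"
  shows "2 * card {x \<in> odds_below B. B div gcd x B = n} = totient n"
proof -
  obtain d where B: "B = n * d" using assms(2) by auto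
  have "d > 0" "B > 0" using B assms(1) by (auto intro!: Nat.gr0I)
  let ?G = "{k \<in> {0<..B}. gcd k B = d}"
  have "B \<noteq> d" using B \<open>d > 0\<close> assms(3) by auto
  have div_iff: "B div gcd x B = n \<longleftrightarrow> gcd x B = d" for x
  proof
    assume "B div gcd x B = n"
    then have "B = n * gcd x B" by (metis dvd_div_mult_self gcd_dvd2)
    with B have "n * gcd x B = n * d" by argo
    moreover have "0 < n" using assms(3) by simp
    ultimately show "gcd x B = d" by (simp only: nat_mult_eq_cancel1)
  next
    assume "gcd x B = d"
    with B \<open>d > 0\<close> show "B div gcd x B = n" by (metis nonzero_mult_div_cancel_right not_gr0)
  qed
  have odd_part: "{x \<in> odds_below B. B div gcd x B = n} = {k \<in> ?G. odd k}"
    unfolding div_iff using \<open>B \<noteq> d\<close>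
    by (auto simp: odds_below_def odd_pos order.order_iff_strict)
  have "bij_betw (\<lambda>k. B - k) {k \<in> ?G. odd k} {k \<in> ?G. even k}"
  proof (rule bij_betw_byWitness[where f' = "\<lambda>k. B - k"])
    have *: "0 < B - k \<and> gcd (B - k) B = d \<and> (odd (B - k) \<longleftrightarrow> even k)" if "k \<in> ?G" for k
    proof -
      have k: "k \<le> B" "gcd k B = d" using that by auto
      then have "k < B" using \<open>B \<noteq> d\<close> by (auto simp: order.order_iff_strict)
      moreover have "gcd (B - k) B = d"
        using k gcd_diff2_nat[of k B] by (simp add: gcd.commute)
      ultimately show ?thesis using \<open>odd B\<close> by (simp add: even_diff_nat)
    qed
    show "(\<lambda>k. B - k) ` {k \<in> ?G. odd k} \<subseteq> {k \<in> ?G. even k}"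
      "(\<lambda>k. B - k) ` {k \<in> ?G. even k} \<subseteq> {k \<in> ?G. odd k}"
      using * by force+
  qed auto
  then have "card {k \<in> ?G. odd k} = card {k \<in> ?G. even k}"
    by (rule bij_betw_same_card)
  moreover have "card ?G = card {k \<in> ?G. odd k} + card {k \<in> ?G. even k}"
    by (subst card_Un_disjoint[symmetric]) (auto intro!: arg_cong[where f = card])
  moreover have "card ?G = totient n"
    using card_gcd_eq_totient[of B d] \<open>B > 0\<close> \<open>d > 0\<close> by (simp add: B)
  ultimately show ?thesis unfolding odd_part by simp
qed

text \<open>The points are grouped by the modulus \<open>B div gcd x B\<close>, which determines the
  period; a modulus \<open>n\<close> contributes \<open>totient n / 2\<close> points. Hence
  \<open>mu B a\<close> is the number of cycles of length \<open>a\<close>.\<close>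

lemma card_odds_below_least_power:
  assumes "odd B" "a > 0"
  shows "real (card {x \<in> odds_below B. least_power (fold_double B) x = a}) = real a * mu B a"
proof -
  let ?X = "{x \<in> odds_below B. least_power (fold_double B) x = a}"
  let ?N = "{n. n dvd B \<and> n > 1 \<and> lam n = a}"
  let ?h = "\<lambda>x. B div gcd x B"
  have B: "B > 0" using assms(1) by (rule odd_pos)
  have finN: "finite ?N" by (rule finite_subset[of _ "{..B}"]) (use B in \<open>auto dest: dvd_imp_le\<close>)
  have gt1: "?h x > 1" if "x \<in> odds_below B" for x
  proof -
    have "gcd x B \<le> x" using that by (intro dvd_imp_le) (auto simp: odds_below_def odd_pos)
    then have "gcd x B < B" using that by (simp add: odds_below_def)
    then show ?thesis using B
      by (metis Suc_lessI dvd_div_eq_0_iff dvd_div_eq_mult gcd_dvd2 gcd_eq_0_iff less_irrefl mult_1 neq0_conv One_nat_def)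
  qed
  have img: "?h ` ?X \<subseteq> ?N"
  proof clarify
    fix x assume x: "x \<in> odds_below B" "a = least_power (fold_double B) x"
    have "?h x dvd B" using div_dvd_iff_mult[of "gcd x B" B B] B by (simp add: div_dvd_div dvd_div_iff_mult)
    then show "?h x dvd B \<and> 1 < ?h x \<and> lam (?h x) = least_power (fold_double B) x"
      using gt1[OF x(1)] least_power_fold_double[OF assms(1) x(1)] by simp
  qed
  have 1: "card ?X = (\<Sum>n\<in>?N. card {x \<in> ?X. ?h x = n})"
    using sum.group[OF _ finN img, of "\<lambda>_. 1::nat"] by simp
  have "real (card ?X) = (\<Sum>n\<in>?N. real (card {x \<in> ?X. ?h x = n}))"
    unfolding 1 by (rule of_nat_sum)
  also have "\<dots> = (\<Sum>n\<in>?N. real (totient n) / 2)"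
  proof (rule sum.cong[OF refl])
    fix n assume n: "n \<in> ?N"
    then have "{x \<in> ?X. ?h x = n} = {x \<in> odds_below B. ?h x = n}"
      using least_power_fold_double[OF assms(1)] by auto
    moreover have "2 * card {x \<in> odds_below B. ?h x = n} = totient n"
      using n card_odds_below_gcd[OF assms(1)] by blast
    ultimately have "2 * card {x \<in> ?X. ?h x = n} = totient n" by (simp only:)
    then show "real (card {x \<in> ?X. ?h x = n}) = real (totient n) / 2"
      by linarith
  qed
  also have "\<dots> = real a * mu B a"
    unfolding mu_def sum_distrib_left using assms(2) by (intro sum.cong refl) simp
  finally show ?thesis .
qed

section \<open>The four-digit Kaprekar map\<close>

text \<open>\<open>x\<close> is the difference of the two outer and \<open>y\<close> that of the two inner sorted digits.\<close>

definition difference_string :: "nat \<Rightarrow> nat \<Rightarrow> nat \<Rightarrow> nat list" where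
  "difference_string B x y = string_of_number B (x * (B ^ 3 - 1) + y * (B ^ 2 - B))"

section \<open>Digits of a difference and the next step\<close>

lemma string_of_number_digits:
  assumes "p < B" "q < B" "r < B" "s < B"
  shows "string_of_number B (p * B ^ 3 + q * B ^ 2 + r * B + s) = [p, q, r, s]"
proof -
  have B: "B > 0" using assms(1) by simp
  \<comment> \<open>In Horner form each division by \<open>B\<close> peels off one digit.\<close>
  define n where "n = ((p * B + q) * B + r) * B + s"
  have n: "p * B ^ 3 + q * B ^ 2 + r * B + s = n"
    by (simp add: n_def power2_eq_square power3_eq_cube algebra_simps)
  have 1: "n div B = (p * B + q) * B + r" "n mod B = s"
    using assms(4) B by (simp_all add: n_def)
  then have 2: "n div B div B = p * B + q" "n div B mod B = r"
    using assms(3) B by simp_all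
  then have 3: "n div B div B div B = p" "n div B div B mod B = q"
    using assms(2) B by simp_all
  have "n div B ^ 2 = n div B div B" "n div B ^ 3 = n div B div B div B"
    by (simp_all add: power2_eq_square power3_eq_cube div_mult2_eq)
  then show ?thesis
    unfolding n string_of_number_def using 1 2 3 assms(1) by simp
qed

text \<open>Borrowing in \<open>x * B ^ 3 + y * B ^ 2 - y * B - x\<close> lowers the second
  coefficient by one and makes the last two nonnegative. The identity is verified over the
  integers.\<close>

lemma difference_string_eq:
  assumes "0 < x" "x < B" "0 < y" "y < B"
  shows "difference_string B x y = [x, y - 1, B - 1 - y, B - x]"
proof -
  have y: "int (y - 1) = int y - 1" "int (B - 1 - y) = int B - 1 - int y" "int (B - x) = int B - int x"
    using assms by auto
  have "int (x * (B ^ 3 - 1) + y * (B ^ 2 - B)) = int x * (int B ^ 3 - 1) + int y * (int B ^ 2 - int B)"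
    using assms by (simp add: of_nat_diff power2_eq_square)
  also have "\<dots> = int (x * B ^ 3 + (y - 1) * B ^ 2 + (B - 1 - y) * B + (B - x))"
    unfolding of_nat_add of_nat_mult of_nat_power y
    by (simp add: algebra_simps power2_eq_square)
  finally have "x * (B ^ 3 - 1) + y * (B ^ 2 - B) = x * B ^ 3 + (y - 1) * B ^ 2 + (B - 1 - y) * B + (B - x)"
    by (simp only: of_nat_eq_iff)
  then show ?thesis
    unfolding difference_string_def using assms by (simp only:) (intro string_of_number_digits, auto)
qed

text \<open>With no inner difference to stop it, the borrow runs through to the leading
  digit.\<close>

lemma difference_string_0:
  assumes "0 < x" "x < B"
  shows "difference_string B x 0 = [x - 1, B - 1, B - 1, B - x]"
proof -
  have x: "int (x - 1) = int x - 1" "int (B - 1) = int B - 1" "int (B - x) = int B - int x"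
    using assms by auto
  have "int (x * (B ^ 3 - 1) + 0 * (B ^ 2 - B)) = int x * (int B ^ 3 - 1)"
    using assms by (simp add: of_nat_diff)
  also have "\<dots> = int ((x - 1) * B ^ 3 + (B - 1) * B ^ 2 + (B - 1) * B + (B - x))"
    unfolding of_nat_add of_nat_mult of_nat_power x
    by (simp add: algebra_simps power2_eq_square power3_eq_cube)
  finally have "x * (B ^ 3 - 1) + 0 * (B ^ 2 - B) = (x - 1) * B ^ 3 + (B - 1) * B ^ 2 + (B - 1) * B + (B - x)"
    by (simp only: of_nat_eq_iff)
  then show ?thesis
    unfolding difference_string_def using assms by (simp only:) (intro string_of_number_digits, auto)
qed

lemma kaprekar_eq_difference_string:
  assumes "mset s = {#a, b, c, d#}" "a \<ge> b" "b \<ge> c" "c \<ge> d" "B > 0"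
  shows "kaprekar B s = difference_string B (a - d) (b - c)"
proof -
  have sort: "sort s = [d, c, b, a]"
    by (rule properties_for_sort) (use assms in auto)
  obtain u v where uv: "a = d + u" "b = c + v"
    using assms by (metis le_add_diff_inverse le_trans)
  have "1 \<le> B ^ 3" "B \<le> B ^ 2"
    using \<open>B > 0\<close> by (auto simp: Suc_le_eq power2_eq_square)
  \<comment> \<open>These forms eliminate the truncated subtractions and leave a polynomial identity
    over the naturals.\<close>
  then obtain m k where mk: "B ^ 3 = 1 + m" "B ^ 2 = B + k"
    by (metis le_add_diff_inverse)
  have "string_value B (rev (sort s)) = string_value B (sort s) + (u * (B ^ 3 - 1) + v * (B ^ 2 - B))"
    unfolding sort string_value_def mk by (simp add: uv algebra_simps)
  then show ?thesis
    unfolding kaprekar_def difference_string_def by (simp add: uv)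
qed

lemma kaprekar_nonconstant:
  assumes "s \<in> nonconstant_strings B"
  obtains x y where "0 < x" "x < B" "y \<le> x" "kaprekar B s = difference_string B x y"
proof -
  have s: "length s = 4" "set s \<subseteq> {0..<B}" "\<exists>x\<in>set s. \<exists>y\<in>set s. x \<noteq> y"
    using assms by (auto simp: nonconstant_strings_def digit_strings_def)
  have "\<exists>d c b a. xs = [d, c, b, a]" if "length xs = 4" for xs :: "nat list"
    using that by (auto simp: eval_nat_numeral length_Suc_conv)
  from this[of "sort s"] s(1) obtain d c b a where sort: "sort s = [d, c, b, a]"
    by auto
  have mset: "mset s = {#a, b, c, d#}"
    using sort by (metis add_mset_commute mset.simps mset_sort)
  have "sorted [d, c, b, a]" unfolding sort[symmetric] by simp
  then have sorted: "d \<le> c" "c \<le> b" "b \<le> a" by auto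
  have set: "set s = {a, b, c, d}"
    using arg_cong[OF sort, of set] by auto
  have "d < a"
    using s(3) sorted unfolding set by auto
  show thesis
  proof
    show "0 < a - d" "a - d < B" using \<open>d < a\<close> s(2) unfolding set by auto
    show "b - c \<le> a - d" using sorted by simp
    show "kaprekar B s = difference_string B (a - d) (b - c)"
      using mset sorted s(2) unfolding set by (intro kaprekar_eq_difference_string) auto
  qed
qed

text \<open>The numbers \<open>x\<close> and \<open>B - x\<close> have sum \<open>B\<close> and
  distance \<open>fold_double B x\<close>; \<open>p\<close> names the larger one, which spares later
  case distinctions.\<close>

lemma fold_double_split:
  assumes "x \<le> B"
  obtains p p' where "p + p' = B" "p = p' + fold_double B x" "{#x, B - x#} = {#p, p'#}"
proof (cases "B \<le> 2 * x")
  case True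
  then show ?thesis using assms that[of x "B - x"] by (simp add: fold_double_def)
next
  case False
  then show ?thesis using assms that[of "B - x" x] by (simp add: fold_double_def add_mset_commute)
qed

text \<open>The digits form two pairs, with sums \<open>B\<close> and \<open>B - 2\<close> and
  distances \<open>u\<close> and \<open>v\<close>. If \<open>u\<close> and \<open>v\<close> differ,
  the pair with the smaller distance lies within the other, so the sorted differences are just
  \<open>u\<close> and \<open>v\<close>. If they agree, the pairs interlace, shifted by one, which
  gives \<open>u + 1\<close> and \<open>u - 1\<close>.\<close>

lemma kaprekar_difference_string:
  assumes "odd B" "0 < x" "x < B" "0 < y" "y < B"
  defines "u \<equiv> fold_double B x" and "v \<equiv> fold_double B y"
  shows "kaprekar B (difference_string B x y) =
    (if u = v then difference_string B (u + 1) (u - 1)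
     else difference_string B (max u v) (min u v))"
proof -
  obtain p p' where p: "p + p' = B" "p = p' + u" "{#x, B - x#} = {#p, p'#}"
    unfolding u_def by (rule fold_double_split[OF less_imp_le[OF assms(3)]])
  \<comment> \<open>The digits \<open>y - 1\<close> and \<open>B - 1 - y\<close> add up to \<open>B - 2\<close> and differ by \<open>v\<close>.\<close>
  have v: "fold_double (B - 2) (y - 1) = v"
    using assms(4,5) by (auto simp: fold_double_def v_def)
  have "y - 1 \<le> B - 2" using assms(5) by simp
  then obtain q q' where q: "q + q' = B - 2" "q = q' + v" "{#y - 1, B - 2 - (y - 1)#} = {#q, q'#}"
    unfolding v[symmetric] by (rule fold_double_split)
  have "B \<ge> 2" using assms(4,5) by simp
  have uv: "odd u" "odd v" using odd_fold_double[OF \<open>odd B\<close>] by (simp_all add: u_def v_def)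
  have "B - 2 - (y - 1) = B - 1 - y" using assms(4) by simp
  then have "{#y - 1, B - 1 - y#} = {#q, q'#}" using q(3) by simp
  moreover have "mset (difference_string B x y) = {#x, B - x#} + {#y - 1, B - 1 - y#}"
    by (simp add: difference_string_eq[OF assms(2-5)] add_mset_commute)
  ultimately have "mset (difference_string B x y) = {#p, p'#} + {#q, q'#}"
    by (simp only: p(3))
  then have mset: "mset (difference_string B x y) = {#p, q, q', p'#}"
      "mset (difference_string B x y) = {#p, q, p', q'#}"
      "mset (difference_string B x y) = {#q, p, p', q'#}"
    by (simp_all add: add_mset_commute)
  consider "u = v" | "v < u" | "u < v" by linarith
  then show ?thesis
  proof cases
    case 1
    have "u > 0" using uv by (simp add: odd_pos)
    then have "p \<ge> q" "q \<ge> p'" "p' \<ge> q'" "p - q' = u + 1" "q - p' = u - 1"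
      using p q 1 \<open>B \<ge> 2\<close> by linarith+
    then show ?thesis
      using kaprekar_eq_difference_string[OF mset(2), of B] 1 \<open>B \<ge> 2\<close> by simp
  next
    case 2
    have "p \<ge> q" "q \<ge> q'" "q' \<ge> p'" "p - p' = u" "q - q' = v"
      using p q 2 \<open>B \<ge> 2\<close> by linarith+
    then show ?thesis
      using kaprekar_eq_difference_string[OF mset(1), of B] 2 \<open>B \<ge> 2\<close> by simp
  next
    case 3
    have "q \<ge> p" "p \<ge> p'" "p' \<ge> q'" "p - p' = u" "q - q' = v"
      using p q 3 \<open>B \<ge> 2\<close> by linarith+
    then show ?thesis
      using kaprekar_eq_difference_string[OF mset(3), of B] 3 \<open>B \<ge> 2\<close> by simp
  qed
qed

text \<open>Two digits are \<open>B - 1\<close>, and the other two, \<open>x - 1\<close> and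
  \<open>B - x\<close>, add up to \<open>B - 1\<close>. Subtracting the smaller of these from
  \<open>B - 1\<close> thus gives the larger, and conversely.\<close>

lemma kaprekar_difference_string_0:
  assumes "0 < x" "x < B"
  shows "kaprekar B (difference_string B x 0) =
    difference_string B (max (x - 1) (B - x)) (min (x - 1) (B - x))"
proof (cases "B - x \<le> x - 1")
  case True
  have "mset (difference_string B x 0) = {#B - 1, B - 1, x - 1, B - x#}"
    by (simp add: difference_string_0[OF assms] add_mset_commute)
  from kaprekar_eq_difference_string[OF this, of B] show ?thesis
    using True assms by (simp add: max_def min_def)
next
  case False
  have "mset (difference_string B x 0) = {#B - 1, B - 1, B - x, x - 1#}"
    by (simp add: difference_string_0[OF assms] add_mset_commute)
  from kaprekar_eq_difference_string[OF this, of B] show ?thesis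
    using False assms by (simp add: max_def min_def)
qed

section \<open>Strings coming from pairs of distinct odd numbers\<close>

definition odd_doubletons :: "nat \<Rightarrow> nat set set" where
  "odd_doubletons B = {A. A \<subseteq> odds_below B \<and> card A = 2}"

definition doubleton_string :: "nat \<Rightarrow> nat set \<Rightarrow> nat list" where
  "doubleton_string B A = difference_string B (Max A) (Min A)"

lemma odd_doubletonsE:
  assumes "A \<in> odd_doubletons B"
  obtains u v where "A = {u, v}" "v < u" "odd u" "odd v" "u < B"
    "doubleton_string B A = difference_string B u v"
proof -
  obtain a b where ab: "A = {a, b}" "a \<noteq> b" "a \<in> odds_below B" "b \<in> odds_below B"
    using assms by (auto simp: odd_doubletons_def card_2_iff)
  show thesis
    by (rule that[of "max a b" "min a b"])
      (use ab in \<open>auto simp: odds_below_def doubleton_string_def max_def min_def\<close>)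
qed

lemma difference_string_mem:
  assumes "odd u" "odd v" "u < B" "v < B" "u \<noteq> v"
  shows "difference_string B (max u v) (min u v) \<in> doubleton_string B ` odd_doubletons B"
proof (rule image_eqI)
  show "difference_string B (max u v) (min u v) = doubleton_string B {u, v}"
    by (simp add: doubleton_string_def)
  show "{u, v} \<in> odd_doubletons B"
    using assms by (simp add: odd_doubletons_def odds_below_def)
qed

text \<open>Injectivity of \<open>fold_double B\<close> on the odd numbers rules out the exceptional
  case of equal values. The Kaprekar map on these strings is therefore conjugate to the image action
  on two-element sets.\<close>

lemma kaprekar_doubleton_string:
  assumes "odd B" "A \<in> odd_doubletons B"
  shows "kaprekar B (doubleton_string B A) = doubleton_string B (fold_double B ` A)"
    and "fold_double B ` A \<in> odd_doubletons B"
proof -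
  from assms(2) show "fold_double B ` A \<in> odd_doubletons B"
    using fold_double_odds_below[OF assms(1)] inj_on_subset[OF inj_on_fold_double[OF assms(1)]]
    by (auto simp: odd_doubletons_def card_image)
  from assms(2) obtain u v where A: "A = {u, v}" "v < u" "odd u" "odd v" "u < B"
      "doubleton_string B A = difference_string B u v"
    by (rule odd_doubletonsE)
  have "fold_double B u \<noteq> fold_double B v"
    using A inj_onD[OF inj_on_fold_double[OF assms(1)], of u v] by (auto simp: odds_below_def)
  moreover have "0 < u" "0 < v" using A by (auto simp: odd_pos)
  ultimately have "kaprekar B (doubleton_string B A) =
      difference_string B (max (fold_double B u) (fold_double B v)) (min (fold_double B u) (fold_double B v))"
    using A kaprekar_difference_string[OF assms(1), of u v] by simp
  then show "kaprekar B (doubleton_string B A) = doubleton_string B (fold_double B ` A)"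
    by (simp add: A(1) doubleton_string_def)
qed

lemma inj_on_doubleton_string: "inj_on (doubleton_string B) (odd_doubletons B)"
proof (rule inj_onI)
  fix A A' assume "A \<in> odd_doubletons B" "A' \<in> odd_doubletons B"
    and eq: "doubleton_string B A = doubleton_string B A'"
  obtain u v where A: "A = {u, v}" "v < u" "odd u" "odd v" "u < B"
      "doubleton_string B A = difference_string B u v"
    using \<open>A \<in> odd_doubletons B\<close> by (rule odd_doubletonsE)
  obtain u' v' where A': "A' = {u', v'}" "v' < u'" "odd u'" "odd v'" "u' < B"
      "doubleton_string B A' = difference_string B u' v'"
    using \<open>A' \<in> odd_doubletons B\<close> by (rule odd_doubletonsE)
  have "0 < u" "0 < v" "0 < u'" "0 < v'" using A A' by (auto simp: odd_pos)
  then have "u = u'" "v = v'"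
    using eq difference_string_eq[of u B v] difference_string_eq[of u' B v'] A A' by auto
  then show "A = A'" using A A' by simp
qed

lemma doubleton_string_nonconstant:
  "doubleton_string B ` odd_doubletons B \<subseteq> nonconstant_strings B"
proof clarify
  fix A assume "A \<in> odd_doubletons B"
  then obtain u v where A: "A = {u, v}" "v < u" "odd u" "odd v" "u < B"
      "doubleton_string B A = difference_string B u v"
    by (rule odd_doubletonsE)
  have "0 < u" "0 < v" using A by (auto simp: odd_pos)
  then have str: "doubleton_string B A = [u, v - 1, B - 1 - v, B - u]"
    using A difference_string_eq[of u B v] by simp
  have "\<exists>x\<in>set [u, v - 1, B - 1 - v, B - u]. \<exists>y\<in>set [u, v - 1, B - 1 - v, B - u]. x \<noteq> y"
    using A(2) by (intro bexI[of _ u] bexI[of _ "v - 1"]) auto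
  moreover have "set [u, v - 1, B - 1 - v, B - u] \<subseteq> {0..<B}"
    using A(2,5) \<open>0 < u\<close> by auto
  ultimately show "doubleton_string B A \<in> nonconstant_strings B"
    unfolding str nonconstant_strings_def digit_strings_def mem_Collect_eq by simp
qed

section \<open>Every nonconstant string reaches a pair of distinct odd numbers\<close>

text \<open>These are the two degenerate difference pairs met below. Both move to
  \<open>(B - 2, 1)\<close>, whose entries are odd and, because \<open>B > 3\<close>,
  distinct.\<close>

lemma reaches_doubleton_string_special:
  assumes "odd B" "B > 3"
  shows "\<exists>m. (kaprekar B ^^ m) (difference_string B 2 0) \<in> doubleton_string B ` odd_doubletons B"
    and "\<exists>m. (kaprekar B ^^ m) (difference_string B (B - 1) 0) \<in> doubleton_string B ` odd_doubletons B"
proof -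
  have B: "B > 4" using assms by (cases "B = 4") auto
  have mem: "difference_string B (B - 2) 1 \<in> doubleton_string B ` odd_doubletons B"
    using difference_string_mem[of "B - 2" 1 B] B assms(1) by (simp add: max_absorb1 min_absorb2)
  have "kaprekar B (difference_string B 2 0) = difference_string B (B - 2) 1"
    using kaprekar_difference_string_0[of 2 B] B by (simp add: max_absorb2 min_absorb1)
  then show "\<exists>m. (kaprekar B ^^ m) (difference_string B 2 0) \<in> doubleton_string B ` odd_doubletons B"
    using mem by (intro exI[of _ 1]) simp
  have "kaprekar B (difference_string B (B - 1) 0) = difference_string B (B - 2) 1"
    using kaprekar_difference_string_0[of "B - 1" B] B
    by (simp add: max_absorb1 min_absorb2 numeral_2_eq_2)
  then show "\<exists>m. (kaprekar B ^^ m) (difference_string B (B - 1) 0) \<in> doubleton_string B ` odd_doubletons B"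
    using mem by (intro exI[of _ 1]) simp
qed

lemma funpow_step_ex: "\<exists>m. (f ^^ m) (f s) \<in> T \<Longrightarrow> \<exists>m. (f ^^ m) s \<in> T"
  by (metis funpow_Suc_right o_apply)

text \<open>One step suffices if the folded values differ. If both equal \<open>u\<close>, the next
  pair is \<open>(u + 1, u - 1)\<close>, whose sum \<open>2 * u\<close> is not the odd number
  \<open>B\<close>, so its folded values differ and a second step suffices, except that
  \<open>u = 1\<close> leads to the degenerate pair \<open>(2, 0)\<close>.\<close>

lemma reaches_doubleton_string_pos:
  assumes "odd B" "B > 3" "0 < x" "x < B" "0 < y" "y < B"
  shows "\<exists>m. (kaprekar B ^^ m) (difference_string B x y) \<in> doubleton_string B ` odd_doubletons B"
proof (rule funpow_step_ex)
  let ?T = "doubleton_string B ` odd_doubletons B"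
  have distinct: "difference_string B (max (fold_double B x) (fold_double B y)) (min (fold_double B x) (fold_double B y)) \<in> ?T"
    if "0 < x" "x < B" "0 < y" "y < B" "fold_double B x \<noteq> fold_double B y" for x y
    using that odd_fold_double[OF assms(1)] fold_double_less by (intro difference_string_mem) auto
  let ?u = "fold_double B x"
  have u: "odd ?u" "?u < B"
    using assms odd_fold_double[OF assms(1)] fold_double_less by auto
  show "\<exists>m. (kaprekar B ^^ m) (kaprekar B (difference_string B x y)) \<in> ?T"
  proof (cases "?u = fold_double B y")
    case False
    then show ?thesis
      using distinct[OF assms(3-6) False] kaprekar_difference_string[OF assms(1,3-6)]
      by (intro exI[of _ 0]) simp
  next
    case True
    then have step: "kaprekar B (difference_string B x y) = difference_string B (?u + 1) (?u - 1)"
      using kaprekar_difference_string[OF assms(1,3-6)] by simp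
    show ?thesis
    proof (cases "?u = 1")
      case True
      then show ?thesis
        unfolding step using reaches_doubleton_string_special(1)[OF assms(1,2)] by (simp add: numeral_2_eq_2)
    next
      case False
      have "?u + 1 \<noteq> B" using u(1) assms(1) by (metis even_Suc Suc_eq_plus1)
      then have *: "0 < ?u + 1" "?u + 1 < B" "0 < ?u - 1" "?u - 1 < B"
        using u False odd_pos[OF u(1)] by auto
      have "?u + 1 + (?u - 1) = 2 * ?u" using odd_pos[OF u(1)] by simp
      then have "?u + 1 + (?u - 1) \<noteq> B" using assms(1) by (metis dvd_triv_left)
      then have "fold_double B (?u + 1) \<noteq> fold_double B (?u - 1)"
        unfolding fold_double_eq_iff by simp
      then have "kaprekar B (difference_string B (?u + 1) (?u - 1)) \<in> ?T"
        using distinct[OF *] kaprekar_difference_string[OF assms(1) *] by simp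
      then show ?thesis unfolding step by (intro exI[of _ 1]) simp
    qed
  qed
qed

text \<open>The first image has a difference pair \<open>(x, y)\<close>. If \<open>y = 0\<close>,
  one more step gives the pair formed by \<open>x - 1\<close> and \<open>B - x\<close>, which is
  positive unless \<open>x = 1\<close>; that exception is the degenerate pair
  \<open>(B - 1, 0)\<close>.\<close>

lemma reaches_doubleton_string:
  assumes "odd B" "B > 3" "s \<in> nonconstant_strings B"
  shows "\<exists>m. (kaprekar B ^^ m) s \<in> doubleton_string B ` odd_doubletons B"
proof (rule funpow_step_ex)
  let ?T = "doubleton_string B ` odd_doubletons B"
  obtain x y where xy: "0 < x" "x < B" "y \<le> x" "kaprekar B s = difference_string B x y"
    using assms(3) by (rule kaprekar_nonconstant)
  show "\<exists>m. (kaprekar B ^^ m) (kaprekar B s) \<in> ?T"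
  proof (cases "y = 0")
    case False
    then show ?thesis
      unfolding xy(4) using xy by (intro reaches_doubleton_string_pos assms) auto
  next
    case True
    have step: "kaprekar B (kaprekar B s) = difference_string B (max (x - 1) (B - x)) (min (x - 1) (B - x))"
      unfolding xy(4) True using xy by (intro kaprekar_difference_string_0)
    show ?thesis
    proof (rule funpow_step_ex, cases "x = 1")
      case True
      then show "\<exists>m. (kaprekar B ^^ m) (kaprekar B (kaprekar B s)) \<in> ?T"
        unfolding step using reaches_doubleton_string_special(2)[OF assms(1,2)] by simp
    next
      case False
      then show "\<exists>m. (kaprekar B ^^ m) (kaprekar B (kaprekar B s)) \<in> ?T"
        unfolding step using xy by (intro reaches_doubleton_string_pos assms) auto
    qed
  qed
qed

text \<open>Each cycle meets the set of strings of odd pairs, and this set is closed under the map,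
  so the cycle, being the orbit of any of its elements, lies inside it.\<close>

lemma terminal_cycles_eq:
  assumes "odd B" "B > 3"
  shows "terminal_cycles B =
    {C. C \<subseteq> doubleton_string B ` odd_doubletons B \<and> cyclic_on (kaprekar B) C}"
proof -
  let ?T = "doubleton_string B ` odd_doubletons B"
  have closed: "kaprekar B ` ?T \<subseteq> ?T"
    using kaprekar_doubleton_string[OF assms(1)] by auto
  have "C \<subseteq> ?T" if C: "C \<subseteq> nonconstant_strings B" "cyclic_on (kaprekar B) C" for C
  proof -
    obtain s where s: "s \<in> C" using C(2) by (auto simp: cyclic_on_def)
    then obtain m where m: "(kaprekar B ^^ m) s \<in> ?T"
      using C(1) reaches_doubleton_string[OF assms] by blast
    have "(kaprekar B ^^ m) s \<in> C" using C(2) s by (rule cyclic_on_funpow_in)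
    then have "C = orbit (kaprekar B) ((kaprekar B ^^ m) s)"
      using orbit_cyclic_eq3[OF C(2)] by simp
    then show ?thesis using orbit_subset_of_closed[OF closed m] by (simp only:)
  qed
  then show ?thesis
    unfolding terminal_cycles_def using doubleton_string_nonconstant by blast
qed

text \<open>The injective encoding \<open>doubleton_string B\<close> intertwines the two maps, so a
  pair and its string have the same period. Counting periodic points by cycles then gives the factor
  \<open>L\<close>.\<close>

lemma num_terminal_cycles_mult:
  assumes "odd B" "B > 3"
  shows "L * num_terminal_cycles B L =
    card {A. A \<subseteq> odds_below B \<and> card A = 2 \<and> least_power ((`) (fold_double B)) A = L}"
proof -
  let ?D = "odd_doubletons B" and ?h = "doubleton_string B"
  let ?F = "(`) (fold_double B)"
  have finD: "finite ?D"
    by (rule finite_subset[of _ "Pow (odds_below B)"]) (auto simp: odd_doubletons_def)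
  have FD: "?F ` ?D \<subseteq> ?D"
    using kaprekar_doubleton_string(2)[OF assms(1)] by auto
  have funpow: "(kaprekar B ^^ n) (?h A) = ?h ((?F ^^ n) A) \<and> (?F ^^ n) A \<in> ?D" if "A \<in> ?D" for n A
    using that by (induction n) (auto simp: kaprekar_doubleton_string[OF assms(1)])
  have "inj_on ?F ?D"
    using inj_on_image_eq_iff[OF inj_on_fold_double[OF assms(1)]]
    by (auto intro!: inj_onI simp: odd_doubletons_def)
  then have per: "A \<in> orbit ?F A" if "A \<in> ?D" for A
    using self_in_orbit_of_inj_on[OF finD FD _ that] by blast
  have fixed: "(kaprekar B ^^ n) (?h A) = ?h A \<longleftrightarrow> (?F ^^ n) A = A" if "A \<in> ?D" for n A
    using funpow[OF that, of n] inj_onD[OF inj_on_doubleton_string, of B "(?F ^^ n) A" A] that by auto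
  have lp: "least_power (kaprekar B) (?h A) = least_power ?F A" if "A \<in> ?D" for A
    unfolding least_power_def fixed[OF that] ..
  have "L * card {C. C \<subseteq> ?h ` ?D \<and> cyclic_on (kaprekar B) C \<and> card C = L} =
      card {s \<in> ?h ` ?D. least_power (kaprekar B) s = L}"
  proof (rule card_cycles)
    show "finite (?h ` ?D)" using finD by simp
    show "kaprekar B ` ?h ` ?D \<subseteq> ?h ` ?D"
      using kaprekar_doubleton_string[OF assms(1)] by auto
    fix s assume "s \<in> ?h ` ?D"
    then obtain A where A: "A \<in> ?D" "s = ?h A" by auto
    have "(?F ^^ least_power ?F A) A = A" "0 < least_power ?F A"
      using per[OF A(1)] funpow_least_power least_power_pos by metis+
    then have "(kaprekar B ^^ least_power ?F A) s = s" using fixed[OF A(1)] A(2) by simp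
    then show "s \<in> orbit (kaprekar B) s"
      using \<open>0 < least_power ?F A\<close> unfolding orbit_altdef by (metis (mono_tags, lifting) mem_Collect_eq)
  qed
  also have "{s \<in> ?h ` ?D. least_power (kaprekar B) s = L} = ?h ` {A \<in> ?D. least_power ?F A = L}"
    using lp by auto
  also have "card \<dots> = card {A \<in> ?D. least_power ?F A = L}"
    by (rule card_image, rule inj_on_subset[OF inj_on_doubleton_string]) auto
  finally show ?thesis
    unfolding num_terminal_cycles_def terminal_cycles_eq[OF assms]
    by (simp add: odd_doubletons_def conj_assoc)
qed

section \<open>Assembling the cycle count\<close>

theorem theorem4p4:
  fixes B L :: nat
  assumes "odd B" and "B > 3" and "L > 0"
  shows "real (num_terminal_cycles B L) =
    mu B L * of_int \<lfloor>(real L - 1) / 2\<rfloor> + mu B (2 * L) + (mu B L gchoose 2) * real L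
    + (\<Sum>(a, b) | 0 < a \<and> a < b \<and> lcm a b = L. mu B a * mu B b * real (gcd a b))"
proof -
  define c where "c = (\<lambda>a. real (card {x \<in> odds_below B. least_power (fold_double B) x = a}))"
  let ?M = "{(a, b). 0 < a \<and> a < b \<and> lcm a b = L}"
  let ?S = "\<Sum>(a, b)\<in>?M. mu B a * mu B b * real (gcd a b)"
  have c: "c a = real a * mu B a" if "a > 0" for a
    using card_odds_below_least_power[OF assms(1) that] by (simp add: c_def)
  \<comment> \<open>The product \<open>a * b\<close> equals \<open>gcd a b * L\<close>, which is
    where the gcd in the formula comes from.\<close>
  have "c a * c b = real L * (mu B a * mu B b * real (gcd a b))" if "0 < a" "a < b" "lcm a b = L" for a b
  proof -
    have "real a * real b = real (gcd a b) * real L"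
      using that(3) prod_gcd_lcm_nat[of a b] by (metis of_nat_mult)
    then show ?thesis using that by (simp add: c algebra_simps)
  qed
  then have sum: "(\<Sum>(a, b)\<in>?M. c a * c b) = real L * ?S"
    unfolding sum_distrib_left by (intro sum.cong refl) auto
  have floor: "real_of_int \<lfloor>(real L - 1) / 2\<rfloor> = real ((L - 1) div 2)"
    using assms(3) floor_divide_of_nat_eq[of "L - 1" 2, where ?'a = real] by (simp add: of_nat_diff)
  \<comment> \<open>As \<open>mu\<close> is real-valued, the binomial coefficient is the generalised
    one, given by its polynomial.\<close>
  have binom: "mu B L gchoose 2 = mu B L * (mu B L - 1) / 2"
    by (simp add: gbinomial_prod_rev numeral_2_eq_2)
  \<comment> \<open>The factor \<open>2\<close> comes from ordering the pairs and the factor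
    \<open>L\<close> from the \<open>L\<close> sets on each cycle; both cancel at the end.\<close>
  have "2 * (real L * real (num_terminal_cycles B L)) =
      c L * real (2 * ((L - 1) div 2)) + c (2 * L) + c L * (c L - real L) + 2 * (\<Sum>(a, b)\<in>?M. c a * c b)"
    using card_doubletons_least_power[OF finite_odds_below fold_double_odds_below inj_on_fold_double, OF assms(1,1,3)]
    unfolding num_terminal_cycles_mult[OF assms(1,2), symmetric] c_def by simp
  also have "\<dots> = 2 * (real L * (mu B L * real ((L - 1) div 2) + mu B (2 * L)
      + (mu B L * (mu B L - 1) / 2) * real L + ?S))"
    using assms(3) unfolding sum by (simp add: c field_simps)
  finally show ?thesis
    unfolding floor binom using assms(3) by simp
qed

end
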